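(* Let $r,s$ be integers with $1\le s\le2r-3$. There exists a constant $c>0$ (not depending on $n$) such that for any $n\in\mathbb{N}$ with $n\ge r$ there exists a function $f\in C^s[0,1]$ with $\|f\|\le1,\ \|f'\|\le1,\dots,\|f^{(s)}\|\le1$ for which the delete-$1$ $r$-jackknife estimator $\hat f_r$ based on $n$ samples satisfies $$\|\mathbb{E}_p\hat f_r-f(p)\|\ge c\,n^{r-1-s}.$$
   Context: All norms are supremum norms over $[0,1]$ (in $p$ for the bias). $C^s[0,1]$ is the space of functions on $[0,1]$ with continuous $s$-th derivative. The delete-$1$ $r$-jackknife (defined for $n\ge r$) uses $n_i=n-r+i$ and $C_i=\prod_{j\ne i}\frac{n_i}{n_i-n_j}$, $1\le i\le r$; it is the estimator $\hat f_r=\sum_{i=1}^r C_i\,\mathbb{U}_{n,i}$, where $\mathbb{U}_{n,i}$ is the average of $f\big(\frac1{n_i}\sum_{k\in S}X_k\big)$ over all subsets $S\subset\{1,\dots,n\}$ of size $n_i$, and $X_1,\dots,X_n$ are i.i.d. $\mathrm{Bernoulli}(p)$. Thus $\mathbb{E}_p\hat f_r=\sum_{i=1}^rC_i\,\mathbb{E}_pf(\hat p_{n_i})$, where $m\hat p_m\sim\mathrm{Binomial}(m,p)$. *)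

theory Defs
  imports "HOL-Probability.Probability"
begin

definition sup_norm :: "(real \<Rightarrow> real) \<Rightarrow> real" where
  "sup_norm g = (SUP x\<in>{0..1}. \<bar>g x\<bar>)"

text \<open>Derivatives are taken within the unit interval, hence one-sided at 0 and 1;
  values of \<open>f\<close> outside the interval play no role.\<close>

definition nth_deriv :: "nat \<Rightarrow> (real \<Rightarrow> real) \<Rightarrow> real \<Rightarrow> real" where
  "nth_deriv k f = ((\<lambda>g x. vector_derivative g (at x within {0..1})) ^^ k) f"

definition C_space :: "nat \<Rightarrow> (real \<Rightarrow> real) set" where
  "C_space s = {f. (\<forall>k<s. nth_deriv k f differentiable_on {0..1}) \<and>
                   continuous_on {0..1} (nth_deriv s f)}"

text \<open>Only used for \<open>r \<le> n\<close> and \<open>1 \<le> i\<close>, where the subtraction does not truncate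
  and the value is positive.\<close>

definition jk_size :: "nat \<Rightarrow> nat \<Rightarrow> nat \<Rightarrow> nat" where
  "jk_size n r i = n - r + i"

definition jk_coeff :: "nat \<Rightarrow> nat \<Rightarrow> nat \<Rightarrow> real" where
  "jk_coeff n r i = (\<Prod>j\<in>{1..r} - {i}.
     real (jk_size n r i) / (real (jk_size n r i) - real (jk_size n r j)))"

definition U_stat :: "(real \<Rightarrow> real) \<Rightarrow> nat \<Rightarrow> nat \<Rightarrow> (nat \<Rightarrow> real) \<Rightarrow> real" where
  "U_stat f n m X =
     (\<Sum>S | S \<subseteq> {1..n} \<and> card S = m. f ((\<Sum>k\<in>S. X k) / real m)) /
     real (card {S. S \<subseteq> {1..n} \<and> card S = m})"

definition jackknife :: "(real \<Rightarrow> real) \<Rightarrow> nat \<Rightarrow> nat \<Rightarrow> (nat \<Rightarrow> real) \<Rightarrow> real" where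
  "jackknife f n r X = (\<Sum>i=1..r. jk_coeff n r i * U_stat f n (jk_size n r i) X)"

text \<open>The law of \<open>n\<close> independent Bernoulli(\<open>p\<close>) variables, indexed by \<open>{1..n}\<close>;
  coordinates outside the index set are constantly \<open>False\<close>.\<close>

definition bernoulli_sample :: "nat \<Rightarrow> real \<Rightarrow> (nat \<Rightarrow> bool) pmf" where
  "bernoulli_sample n p = Pi_pmf {1..n} False (\<lambda>_. bernoulli_pmf p)"

definition jackknife_mean :: "(real \<Rightarrow> real) \<Rightarrow> nat \<Rightarrow> nat \<Rightarrow> real \<Rightarrow> real" where
  "jackknife_mean f n r p =
     measure_pmf.expectation (bernoulli_sample n p)
       (\<lambda>\<omega>. jackknife f n r (\<lambda>k. of_bool (\<omega> k)))"

end

theory Submission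
  imports Defs
begin

text \<open>
  For \<open>n \<ge> 3 r\<close> the witness is \<open>f x = (2 \<pi> n)\<^sup>-\<^sup>s cos (2 \<pi> n x)\<close>, evaluated at \<open>p = 1/2\<close>.
  A binomial variable \<open>K\<close> with parameters \<open>m = n - j\<close> and \<open>1/2\<close> satisfies
  \<open>E cos (2 \<pi> n K / m) = (-1)\<^sup>j cos (\<pi> j / m)\<^sup>m\<close>, and \<open>(-1)\<^sup>j\<close> is also the sign of the jackknife
  coefficient of the sample size \<open>n - j\<close>. So nothing cancels, and the term \<open>j = 0\<close> alone
  contributes a multiple of \<open>n\<^sup>r\<^sup>-\<^sup>1\<^sup>-\<^sup>s\<close>.
  For the finitely many \<open>n < 3 r\<close>, take the frequency \<open>L = (3 r)!\<close> instead of \<open>n\<close>: every sample size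
  divides \<open>L\<close>, so the estimator is constant, whereas \<open>f\<close> takes the values \<open>\<plusminus> (2 \<pi> L)\<^sup>-\<^sup>s\<close>.
\<close>

section \<open>Scaled cosine waves and their derivatives\<close>

definition wave :: "nat \<Rightarrow> nat \<Rightarrow> real \<Rightarrow> real" where
  "wave s N x = cos (2 * pi * real N * x) / (2 * pi * real N) ^ s"

lemma nth_deriv_Suc:
  "nth_deriv (Suc k) f x = vector_derivative (nth_deriv k f) (at x within {0..1})"
  by (simp add: nth_deriv_def)

text \<open>Differentiating a cosine advances its phase by \<open>pi / 2\<close>, so one closed form
  covers all orders and passes through an induction.\<close>

lemma has_vector_derivative_shifted_cos:
  fixes a b x :: real
  shows "((\<lambda>x. a * b ^ k * cos (b * x + real k * (pi / 2))) has_vector_derivative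
           a * b ^ Suc k * cos (b * x + real (Suc k) * (pi / 2))) (at x within S)"
proof -
  have "cos (b * x + real (Suc k) * (pi / 2)) = - sin (b * x + real k * (pi / 2))"
    using cos_add[of "b * x + real k * (pi / 2)" "pi / 2"]
    by (simp add: algebra_simps add_divide_distrib)
  then have "a * b ^ Suc k * cos (b * x + real (Suc k) * (pi / 2)) =
      a * b ^ k * (- sin (b * x + real k * (pi / 2)) * b)"
    by simp
  moreover have "((\<lambda>x. a * b ^ k * cos (b * x + real k * (pi / 2))) has_real_derivative
      a * b ^ k * (- sin (b * x + real k * (pi / 2)) * b)) (at x within S)"
    by (auto intro!: derivative_eq_intros)
  ultimately show ?thesis
    by (simp only: has_real_derivative_iff_has_vector_derivative)
qed

lemma nth_deriv_cos:
  fixes a b :: real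
  assumes "x \<in> {0..1}"
  shows "nth_deriv k (\<lambda>x. a * cos (b * x)) x = a * b ^ k * cos (b * x + real k * (pi / 2))"
  using assms
proof (induction k arbitrary: x)
  case 0
  then show ?case by (simp add: nth_deriv_def)
next
  case (Suc k)
  \<comment> \<open>The induction hypothesis gives equality on the unit interval only, which
    suffices for a derivative within that interval.\<close>
  show ?case
    unfolding nth_deriv_Suc
    by (intro vector_derivative_within_closed_interval
          has_vector_derivative_transform[OF _ _ has_vector_derivative_shifted_cos] Suc) simp_all
qed

lemma wave_altdef: "wave s N = (\<lambda>x. 1 / (2 * pi * real N) ^ s * cos ((2 * pi * real N) * x))"
  by (simp add: wave_def fun_eq_iff)

lemma wave_in_C_space: "wave s N \<in> C_space s"
proof -
  let ?g = "\<lambda>k x. 1 / (2 * pi * real N) ^ s * (2 * pi * real N) ^ k *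
                   cos ((2 * pi * real N) * x + real k * (pi / 2))"
  have eq: "nth_deriv k (wave s N) x = ?g k x" if "x \<in> {0..1}" for k x
    unfolding wave_altdef by (rule nth_deriv_cos[OF that])
  have deriv: "(nth_deriv k (wave s N) has_vector_derivative ?g (Suc k) x) (at x within {0..1})"
    if "x \<in> {0..1}" for k x
    by (rule has_vector_derivative_transform[OF that eq has_vector_derivative_shifted_cos])
  then have "nth_deriv k (wave s N) differentiable_on {0..1}" for k
    unfolding differentiable_on_def by (blast intro: differentiableI_vector)
  then show ?thesis
    by (auto simp: C_space_def intro: differentiable_imp_continuous_on)
qed

lemma two_pi_nat_ge_1: "N \<ge> 1 \<Longrightarrow> 2 * pi * real N \<ge> 1"
  using mult_mono[of 1 "2 * pi" 1 "real N"] pi_ge_two by simp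

text \<open>The derivative of order \<open>k\<close> has amplitude
  \<open>(2 * pi * N) ^ k / (2 * pi * N) ^ s\<close>, and the base is at least 1.\<close>

lemma sup_norm_nth_deriv_wave:
  assumes "N \<ge> 1" "k \<le> s"
  shows "sup_norm (nth_deriv k (wave s N)) \<le> 1"
  unfolding sup_norm_def
proof (rule cSUP_least)
  fix x :: real assume x: "x \<in> {0..1}"
  let ?b = "2 * pi * real N"
  have b: "?b \<ge> 1" using two_pi_nat_ge_1[OF assms(1)] .
  have "\<bar>nth_deriv k (wave s N) x\<bar> = ?b ^ k / ?b ^ s * \<bar>cos (?b * x + real k * (pi / 2))\<bar>"
    unfolding wave_altdef nth_deriv_cos[OF x] by (simp add: abs_mult power_abs)
  also have "\<dots> \<le> 1 * 1"
  proof (rule mult_mono)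
    show "?b ^ k / ?b ^ s \<le> 1"
      using power_increasing[OF assms(2) b] b by (subst divide_le_eq_1_pos) auto
  qed auto
  finally show "\<bar>nth_deriv k (wave s N) x\<bar> \<le> 1" by simp
qed auto

section \<open>Boundedness of the bias in \<open>p\<close>\<close>

lemma finite_set_bernoulli_sample: "finite (set_pmf (bernoulli_sample n p))"
  unfolding bernoulli_sample_def by (subst set_Pi_pmf) (auto intro!: finite_PiE_dflt)

lemma card_subsets_pos:
  "m \<le> n \<Longrightarrow> card {S. S \<subseteq> {1..n} \<and> card S = m} > 0"
  by (simp add: n_subsets)

lemma average_eq_const:
  fixes c :: real
  assumes "card A > 0" "\<And>x. x \<in> A \<Longrightarrow> g x = c"
  shows "sum g A / real (card A) = c"
proof -
  have "sum g A = real (card A) * c"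
    using sum.cong[of A A g "\<lambda>_. c"] assms(2) by simp
  then show ?thesis using assms(1) by simp
qed

lemma abs_U_stat_le:
  assumes "\<And>x. \<bar>f x\<bar> \<le> B"
  shows "\<bar>U_stat f n m X\<bar> \<le> B"
proof -
  let ?T = "{S. S \<subseteq> {1..n} \<and> card S = m}"
  have "\<bar>\<Sum>S\<in>?T. f ((\<Sum>k\<in>S. X k) / real m)\<bar> \<le> (\<Sum>S\<in>?T. B)"
    by (rule order.trans[OF sum_abs]) (intro sum_mono assms)
  \<comment> \<open>This covers the case of no subset of size \<open>m\<close>, where division by
    zero yields 0.\<close>
  moreover have "B \<ge> 0"
    using assms[of 0] by linarith
  ultimately show ?thesis
    by (cases "card ?T = 0") (auto simp: U_stat_def divide_le_eq mult.commute)
qed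

lemma abs_jackknife_mean_le:
  assumes "\<And>x. \<bar>f x\<bar> \<le> B"
  shows "\<bar>jackknife_mean f n r p\<bar> \<le> (\<Sum>i=1..r. \<bar>jk_coeff n r i\<bar> * B)"
proof -
  let ?M = "\<Sum>i=1..r. \<bar>jk_coeff n r i\<bar> * B"
  have le: "\<bar>jackknife f n r X\<bar> \<le> ?M" for X
    unfolding jackknife_def
    by (rule order.trans[OF sum_abs])
       (auto simp: abs_mult intro!: sum_mono mult_left_mono abs_U_stat_le assms)
  have int: "integrable (bernoulli_sample n p) g" for g :: "(nat \<Rightarrow> bool) \<Rightarrow> real"
    by (intro integrable_measure_pmf_finite finite_set_bernoulli_sample)
  have "\<bar>jackknife_mean f n r p\<bar> \<le> measure_pmf.expectation (bernoulli_sample n p)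
          (\<lambda>\<omega>. \<bar>jackknife f n r (\<lambda>k. of_bool (\<omega> k))\<bar>)"
    unfolding jackknife_mean_def by (rule integral_abs_bound)
  also have "\<dots> \<le> measure_pmf.expectation (bernoulli_sample n p) (\<lambda>_. ?M)"
    by (intro integral_mono int le)
  finally show ?thesis by simp
qed

lemma abs_wave_le: "\<bar>wave s N x\<bar> \<le> 1 / (2 * pi * real N) ^ s"
  by (auto simp: wave_def abs_mult power_abs intro!: divide_right_mono)

text \<open>A real \<open>SUP\<close> dominates each value once the range is bounded above. The
  crude bounds independent of \<open>p\<close> supply this, so a single point can bound the norm
  from below.\<close>

lemma bias_wave_le_sup_norm:
  assumes "p \<in> {0..1}"
  shows "\<bar>jackknife_mean (wave s N) n r p - wave s N p\<bar>
           \<le> sup_norm (\<lambda>p. jackknife_mean (wave s N) n r p - wave s N p)"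
  unfolding sup_norm_def
proof (rule cSUP_upper[OF assms], rule bdd_aboveI2)
  fix x :: real
  let ?B = "1 / (2 * pi * real N) ^ s"
  show "\<bar>jackknife_mean (wave s N) n r x - wave s N x\<bar>
          \<le> (\<Sum>i=1..r. \<bar>jk_coeff n r i\<bar> * ?B) + ?B"
    using abs_jackknife_mean_le[of "wave s N" ?B n r x, OF abs_wave_le] abs_wave_le[of s N x]
    by linarith
qed

section \<open>Cosine moments of fair coins\<close>

text \<open>This is the real part of
  \<open>exp (i \<phi>) * ((1 + exp (i \<theta>)) / 2) ^ card A\<close>, where \<open>1 + exp (i
  \<theta>) = 2 * cos (\<theta> / 2) * exp (i \<theta> / 2)\<close>. The free phase \<phi> absorbs
  the outcome of each added coin in the induction.\<close>

lemma expectation_cos_sum_fair_coins: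
  assumes "finite A"
  shows "measure_pmf.expectation (Pi_pmf A False (\<lambda>_. bernoulli_pmf (1/2)))
           (\<lambda>w. cos (\<phi> + \<theta> * (\<Sum>k\<in>A. of_bool (w k))))
         = cos (\<theta> / 2) ^ card A * cos (\<phi> + real (card A) * (\<theta> / 2))"
  using assms
proof (induction A arbitrary: \<phi> rule: finite_induct)
  case empty
  then show ?case by simp
next
  case (insert x A)
  let ?P = "Pi_pmf A False (\<lambda>_. bernoulli_pmf (1/2))"
  have fin: "finite (set_pmf ?P)"
    using insert.hyps by (subst set_Pi_pmf) (auto intro!: finite_PiE_dflt)
  have sum_upd: "(\<Sum>k\<in>insert x A. of_bool ((w(x := y)) k)) =
      of_bool y + (\<Sum>k\<in>A. of_bool (w k) :: real)" for w y
  proof -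
    have "(\<Sum>k\<in>A. of_bool ((w(x := y)) k)) = (\<Sum>k\<in>A. of_bool (w k) :: real)"
      using insert.hyps by (intro sum.cong) auto
    then show ?thesis
      unfolding sum.insert[OF insert.hyps] by (simp only: fun_upd_same)
  qed
  have E: "measure_pmf.expectation (map_pmf (\<lambda>w. w(x := y)) ?P)
             (\<lambda>w. cos (\<phi> + \<theta> * (\<Sum>k\<in>insert x A. of_bool (w k))))
           = cos (\<theta> / 2) ^ card A * cos (\<phi> + \<theta> * of_bool y + real (card A) * (\<theta> / 2))" for y
    unfolding integral_map_pmf sum_upd insert.IH[symmetric] by (simp add: algebra_simps)
  let ?u = "\<phi> + real (card A) * (\<theta> / 2)"
  have "measure_pmf.expectation (Pi_pmf (insert x A) False (\<lambda>_. bernoulli_pmf (1/2)))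
           (\<lambda>w. cos (\<phi> + \<theta> * (\<Sum>k\<in>insert x A. of_bool (w k))))
      = (\<Sum>y\<in>UNIV. pmf (bernoulli_pmf (1/2)) y *\<^sub>R
           measure_pmf.expectation (map_pmf (\<lambda>w. w(x := y)) ?P)
             (\<lambda>w. cos (\<phi> + \<theta> * (\<Sum>k\<in>insert x A. of_bool (w k)))))"
    unfolding Pi_pmf_insert'[OF insert.hyps] map_pmf_def[symmetric]
    by (rule pmf_expectation_bind) (auto simp: fin)
  also have "\<dots> = cos (\<theta> / 2) ^ card A * ((cos (?u + \<theta>) + cos ?u) / 2)"
    unfolding E by (simp add: UNIV_bool algebra_simps add_divide_distrib)
  \<comment> \<open>Sum-to-product merges the two equally likely outcomes into one more factor
    \<open>cos (\<theta> / 2)\<close> and a phase advance of \<open>\<theta> / 2\<close>.\<close>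
  also have "(cos (?u + \<theta>) + cos ?u) / 2 = cos (\<theta> / 2) * cos (?u + \<theta> / 2)"
  proof -
    have "(?u + \<theta> + ?u) / 2 = ?u + \<theta> / 2" "(?u + \<theta> - ?u) / 2 = \<theta> / 2"
      by (simp_all add: field_simps)
    then show ?thesis
      using cos_plus_cos[of "?u + \<theta>" ?u] by (simp only:) simp
  qed
  finally show ?case
    using insert.hyps by (simp add: algebra_simps add_divide_distrib)
qed

lemma expectation_cos_sum_fair_coins_subset:
  assumes "S \<subseteq> {1..n}"
  shows "measure_pmf.expectation (bernoulli_sample n (1/2))
           (\<lambda>\<omega>. cos (\<theta> * (\<Sum>k\<in>S. of_bool (\<omega> k))))
         = cos (\<theta> / 2) ^ card S * cos (real (card S) * (\<theta> / 2))"
proof -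
  have "finite S" using assms finite_subset by blast
  \<comment> \<open>The law on \<open>S\<close> is that of the full sample with the coordinates
    outside \<open>S\<close> reset to \<open>False\<close>; sums over \<open>S\<close> do not see
    the reset.\<close>
  have "(\<Sum>k\<in>S. of_bool (if k \<in> S then w k else False)) = (\<Sum>k\<in>S. of_bool (w k) :: real)" for w
    by (intro sum.cong) auto
  then show ?thesis
    using expectation_cos_sum_fair_coins[OF \<open>finite S\<close>, of 0 \<theta>]
    unfolding bernoulli_sample_def Pi_pmf_subset[OF finite_atLeastAtMost assms] integral_map_pmf
    by (simp only: add_0_left)
qed

section \<open>Sign and size of the jackknife coefficients\<close>

text \<open>The denominators are \<open>i - j\<close>: factors with \<open>j < i\<close> are
  nonnegative, and the \<open>r - i\<close> factors with \<open>j > i\<close> are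
  nonpositive.\<close>

lemma minus_one_power_mult_jk_coeff_nonneg:
  assumes "i \<in> {1..r}"
  shows "(-1) ^ (r - i) * jk_coeff n r i \<ge> 0"
proof -
  let ?g = "\<lambda>j. real (jk_size n r i) / (real (jk_size n r i) - real (jk_size n r j))"
  have split: "{1..r} - {i} = {1..<i} \<union> {i<..r}" using assms by auto
  have "jk_coeff n r i = prod ?g {1..<i} * prod ?g {i<..r}"
    unfolding jk_coeff_def split by (rule prod.union_disjoint) auto
  moreover have "(-1) ^ (r - i) * prod ?g {i<..r} = (\<Prod>j\<in>{i<..r}. - ?g j)"
    by (subst prod_uminus) simp
  moreover have "(\<Prod>j\<in>{i<..r}. - ?g j) \<ge> 0"
    by (rule prod_nonneg) (auto simp: jk_size_def divide_nonneg_nonpos)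
  moreover have "prod ?g {1..<i} \<ge> 0"
    by (rule prod_nonneg) (auto simp: jk_size_def)
  ultimately show ?thesis
    by (simp only: mult.left_commute[of "(-1) ^ (r - i)"] mult_nonneg_nonneg)
qed

text \<open>For \<open>i = r\<close> the factors are \<open>n / (r - j)\<close> with
  \<open>1 \<le> r - j < r\<close>, each at least \<open>n / r\<close>.\<close>

lemma jk_coeff_last_ge:
  assumes "r \<le> n" "1 \<le> r"
  shows "jk_coeff n r r \<ge> (real n / real r) ^ (r - 1)"
proof -
  have "(real n / real r) ^ (r - 1) = (\<Prod>j\<in>{1..r} - {r}. real n / real r)"
    using assms by simp
  also have "\<dots> \<le> jk_coeff n r r"
    unfolding jk_coeff_def
    using assms by (intro prod_mono conjI) (auto simp: jk_size_def of_nat_diff intro!: divide_left_mono mult_pos_pos)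
  finally show ?thesis .
qed

section \<open>Lower bound at \<open>p = 1/2\<close> for large samples\<close>

text \<open>All subsets of size \<open>m\<close> contribute the same expectation. The half angle is
  \<open>pi * n / m = pi + pi * j / m\<close>, so the two cosine factors carry the signs
  \<open>(-1) ^ m\<close> and \<open>(-1) ^ n\<close>, with product \<open>(-1) ^ j\<close> since
  \<open>n = m + j\<close>.\<close>

lemma expectation_U_stat_wave:
  assumes m: "m + j = n" "m > 0"
  shows "measure_pmf.expectation (bernoulli_sample n (1/2))
           (\<lambda>\<omega>. U_stat (wave s n) n m (\<lambda>k. of_bool (\<omega> k)))
         = (-1) ^ j * cos (pi * real j / real m) ^ m / (2 * pi * real n) ^ s"
proof -
  let ?T = "{S. S \<subseteq> {1..n} \<and> card S = m}"
  let ?\<theta> = "2 * pi * real n / real m"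
  let ?E = "measure_pmf.expectation (bernoulli_sample n (1/2))"
  let ?v = "(-1) ^ j * cos (pi * real j / real m) ^ m / (2 * pi * real n) ^ s"
  have half: "?\<theta> / 2 = pi + pi * real j / real m"
    using m by (auto simp: field_simps)
  have "cos (?\<theta> / 2) ^ m = (-1) ^ m * cos (pi * real j / real m) ^ m"
    unfolding half by (simp add: cos_add power_minus[of "cos _"])
  moreover have "cos (real m * (?\<theta> / 2)) = (-1) ^ n"
    using m(2) by (simp add: cos_npi2)
  moreover have "(-1) ^ m * (-1) ^ n = ((-1) ^ j :: real)"
    using m(1) by (auto simp: power_add simp flip: power_mult_distrib)
  ultimately have trig: "cos (?\<theta> / 2) ^ m * cos (real m * (?\<theta> / 2)) =
      (-1) ^ j * cos (pi * real j / real m) ^ m"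
    using mult.assoc[of "(-1) ^ m" "(-1) ^ n" "cos (pi * real j / real m) ^ m"]
    by (simp only: mult.assoc mult.commute[of "cos _ ^ m"])
  have E: "?E (\<lambda>\<omega>. wave s n ((\<Sum>k\<in>S. of_bool (\<omega> k)) / real m)) = ?v" if "S \<in> ?T" for S
    using expectation_cos_sum_fair_coins_subset[of S n ?\<theta>] that trig
    by (simp add: wave_def)
  have "?E (\<lambda>\<omega>. U_stat (wave s n) n m (\<lambda>k. of_bool (\<omega> k))) =
      (\<Sum>S\<in>?T. ?E (\<lambda>\<omega>. wave s n ((\<Sum>k\<in>S. of_bool (\<omega> k)) / real m))) / real (card ?T)"
    unfolding U_stat_def
    by (subst integral_divide_zero, subst Bochner_Integration.integral_sum)
       (auto intro: integrable_measure_pmf_finite finite_set_bernoulli_sample)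
  also have "\<dots> = ?v"
    using m(1) by (intro average_eq_const E card_subsets_pos) auto
  finally show ?thesis .
qed

text \<open>From \<open>n \<ge> 3 * r\<close> every sample size is at least
  \<open>2 * (r - i)\<close>, which keeps the angles within \<open>pi / 2\<close> and the cosines
  nonnegative. All summands are then nonnegative, and the one for \<open>i = r\<close> is
  kept.\<close>

lemma jackknife_mean_wave_ge:
  assumes "1 \<le> r" "3 * r \<le> n"
  shows "jackknife_mean (wave s n) n r (1/2) \<ge> (real n / real r) ^ (r - 1) / (2 * pi * real n) ^ s"
proof -
  let ?t = "\<lambda>i. jk_coeff n r i * ((-1) ^ (r - i) *
       cos (pi * real (r - i) / real (jk_size n r i)) ^ jk_size n r i / (2 * pi * real n) ^ s)"
  have "jackknife_mean (wave s n) n r (1/2) =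
      (\<Sum>i=1..r. jk_coeff n r i * measure_pmf.expectation (bernoulli_sample n (1/2))
           (\<lambda>\<omega>. U_stat (wave s n) n (jk_size n r i) (\<lambda>k. of_bool (\<omega> k))))"
    unfolding jackknife_mean_def jackknife_def
    by (subst Bochner_Integration.integral_sum)
       (auto intro: integrable_measure_pmf_finite finite_set_bernoulli_sample)
  also have "\<dots> = sum ?t {1..r}"
    using assms by (intro sum.cong refl arg_cong2[of _ _ _ _ "(*)"] expectation_U_stat_wave)
      (auto simp: jk_size_def)
  finally have eq: "jackknife_mean (wave s n) n r (1/2) = sum ?t {1..r}" .
  have "?t i \<ge> 0" if i: "i \<in> {1..r}" for i
  proof -
    let ?m = "jk_size n r i"
    have m: "2 * (r - i) \<le> ?m" "?m > 0" using i assms by (auto simp: jk_size_def)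
    have "cos (pi * real (r - i) / real ?m) \<ge> 0"
    proof (rule cos_ge_zero)
      have "2 * real (r - i) \<le> real ?m" using m(1) by linarith
      then have "pi * (2 * real (r - i)) \<le> pi * real ?m" by (intro mult_left_mono) auto
      then show "pi * real (r - i) / real ?m \<le> pi / 2" using m(2) by (simp add: field_simps)
      have "pi * real (r - i) / real ?m \<ge> 0" by simp
      then show "- (pi / 2) \<le> pi * real (r - i) / real ?m" using pi_gt_zero by linarith
    qed
    then have "((-1) ^ (r - i) * jk_coeff n r i) *
        (cos (pi * real (r - i) / real ?m) ^ ?m / (2 * pi * real n) ^ s) \<ge> 0"
      using minus_one_power_mult_jk_coeff_nonneg[OF i] by (intro mult_nonneg_nonneg[OF _ divide_nonneg_nonneg]) auto
    then show ?thesis by (simp add: mult_ac)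
  qed
  then have "?t r \<le> sum ?t {1..r}"
    using assms by (intro member_le_sum) auto
  \<comment> \<open>At \<open>i = r\<close> the angle is 0, so the sign and the cosine are both
    1.\<close>
  moreover have "(real n / real r) ^ (r - 1) / (2 * pi * real n) ^ s \<le> ?t r"
    using jk_coeff_last_ge[of r n] assms by (simp add: divide_right_mono)
  ultimately show ?thesis unfolding eq by linarith
qed

lemma sup_norm_bias_wave_ge_large:
  assumes "2 \<le> r" "3 * r \<le> n"
  shows "sup_norm (\<lambda>p. jackknife_mean (wave s n) n r p - wave s n p)
           \<ge> 1 / (2 * (2 * pi) ^ s * real r ^ (r - 1)) * (real n ^ (r - 1) / real n ^ s)"
proof -
  let ?Q = "(real n / real r) ^ (r - 1)"
  let ?D = "(2 * pi * real n) ^ s"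
  have "real n / real r \<ge> 3" using assms by (simp add: field_simps)
  \<comment> \<open>As \<open>r \<ge> 2\<close>, the exponent is at least 1 and
    \<open>?Q \<ge> 3\<close>. Subtracting the value of the wave at \<open>1/2\<close>, at most
    \<open>1 / ?D\<close>, thus costs at most half; hence the factor 2 in the constant.\<close>
  moreover from this have "real n / real r \<le> ?Q" using assms by (intro self_le_power) auto
  ultimately have "?Q / 2 \<le> ?Q - 1" by linarith
  have D: "?D > 0" using assms by simp
  have "1 / (2 * (2 * pi) ^ s * real r ^ (r - 1)) * (real n ^ (r - 1) / real n ^ s) = ?Q / 2 / ?D"
    by (simp add: power_mult_distrib power_divide)
  also have "\<dots> \<le> (?Q - 1) / ?D"
    using \<open>?Q / 2 \<le> ?Q - 1\<close> D by (intro divide_right_mono) auto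
  also have "\<dots> = ?Q / ?D - 1 / ?D" by (simp add: diff_divide_distrib)
  also have "\<dots> \<le> jackknife_mean (wave s n) n r (1/2) - wave s n (1/2)"
    using jackknife_mean_wave_ge[of r n s] abs_wave_le[of s n "1/2"] assms by linarith
  also have "\<dots> \<le> sup_norm (\<lambda>p. jackknife_mean (wave s n) n r p - wave s n p)"
    using bias_wave_le_sup_norm[of "1/2" s n n r] by auto
  finally show ?thesis .
qed

section \<open>Small samples\<close>

text \<open>A mean of \<open>m\<close> bits is a multiple of \<open>1 / m\<close>, so
  \<open>L\<close> times it is an integer and the cosine equals 1.\<close>

lemma U_stat_wave_eq_const:
  assumes "m dvd L" "0 < m" "m \<le> n"
  shows "U_stat (wave s L) n m (\<lambda>k. of_bool (\<omega> k)) = 1 / (2 * pi * real L) ^ s"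
proof -
  from assms obtain q where q: "L = m * q" by (auto elim: dvdE)
  have "wave s L ((\<Sum>k\<in>S. of_bool (\<omega> k)) / real m) = 1 / (2 * pi * real L) ^ s"
    if "finite S" for S
  proof -
    have "(\<Sum>k\<in>S. of_bool (\<omega> k)) = real (card {k\<in>S. \<omega> k})"
      using that by (simp add: of_bool_def sum.If_cases Int_def)
    moreover have "2 * pi * real L * (real a / real m) = 2 * pi * real (q * a)" for a
      using assms(2) by (simp add: q)
    ultimately have "cos (2 * pi * real L * ((\<Sum>k\<in>S. of_bool (\<omega> k)) / real m)) =
        cos (2 * pi * real (q * card {k\<in>S. \<omega> k}))"
      by (simp only:)
    moreover have "cos (2 * pi * real a) = 1" for a
      using cos_2npi[of a] by (simp only: mult_ac)
    ultimately have "cos (2 * pi * real L * ((\<Sum>k\<in>S. of_bool (\<omega> k)) / real m)) = 1"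
      by (simp only:)
    then show ?thesis by (simp add: wave_def)
  qed
  then show ?thesis
    unfolding U_stat_def using assms(3)
    by (intro average_eq_const card_subsets_pos) (blast intro: finite_subset)+
qed

text \<open>The mean is a constant \<open>?K\<close> in \<open>p\<close>, while the wave equals
  \<open>1 / ?D\<close> at 0 and \<open>- 1 / ?D\<close> half a period later. Whatever
  \<open>?K\<close> is, it is at distance at least \<open>1 / ?D\<close> from one of the
  two.\<close>

lemma sup_norm_bias_wave_ge_small:
  assumes "r \<le> n" "n \<le> N"
  shows "sup_norm (\<lambda>p. jackknife_mean (wave s (fact N)) n r p - wave s (fact N) p)
           \<ge> 1 / (2 * pi * fact N) ^ s"
proof -
  let ?L = "fact N :: nat"
  let ?D = "(2 * pi * real ?L) ^ s"
  let ?K = "\<Sum>i=1..r. jk_coeff n r i * (1 / ?D)"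
  have "jackknife (wave s ?L) n r (\<lambda>k. of_bool (\<omega> k)) = ?K" for \<omega>
    unfolding jackknife_def using assms
    \<comment> \<open>Each sample size lies between 1 and \<open>N\<close>, hence divides
      \<open>fact N\<close>.\<close>
    by (intro sum.cong refl arg_cong2[of _ _ _ _ "(*)"] U_stat_wave_eq_const dvd_fact)
       (auto simp: jk_size_def)
  then have K: "jackknife_mean (wave s ?L) n r p = ?K" for p
    by (simp add: jackknife_mean_def)
  have w0: "wave s ?L 0 = 1 / ?D" by (simp add: wave_def)
  have w1: "wave s ?L (1 / (2 * real ?L)) = - 1 / ?D" by (simp add: wave_def)
  have "1 / (2 * real ?L) \<in> {0..1}"
    using fact_ge_1[of N, where ?'a = real]
    by (simp only: of_nat_fact atLeastAtMost_iff divide_le_eq_1 zero_le_divide_iff) linarith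
  from bias_wave_le_sup_norm[OF this, of s ?L n r] bias_wave_le_sup_norm[of 0 s ?L n r]
  have "1 / ?D \<le> sup_norm (\<lambda>p. jackknife_mean (wave s ?L) n r p - wave s ?L p)"
    unfolding K w0 w1 by (auto simp: abs_if split: if_splits)
  then show ?thesis by simp
qed

section \<open>A constant uniform in \<open>n\<close>\<close>

theorem theorem4:
  fixes r s :: nat
  assumes "1 \<le> s" and "int s \<le> 2 * int r - 3"
  shows "\<exists>c::real. c > 0 \<and>
           (\<forall>n::nat. n \<ge> r \<longrightarrow>
             (\<exists>f. f \<in> C_space s \<and>
                  (\<forall>k\<le>s. sup_norm (nth_deriv k f) \<le> 1) \<and>
                  sup_norm (\<lambda>p. jackknife_mean f n r p - f p)
                    \<ge> c * real n powi (int r - 1 - int s)))"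
proof -
  \<comment> \<open>The bounds on \<open>s\<close> force \<open>2 * r \<ge> 4\<close>.\<close>
  have r: "2 \<le> r" using assms by linarith
  define c1 where "c1 = 1 / (2 * (2 * pi) ^ s * real r ^ (r - 1))"
  \<comment> \<open>For \<open>n < 3 * r\<close> the bias bound is independent of \<open>n\<close>;
    it is divided by \<open>(3 * r) ^ (r - 1)\<close>, which dominates the rate in that
    range.\<close>
  define c2 where "c2 = 1 / (2 * pi * fact (3 * r)) ^ s / (3 * real r) ^ (r - 1)"
  have pos: "c1 > 0" "c2 > 0" using r by (auto simp: c1_def c2_def)
  have "\<exists>f. f \<in> C_space s \<and> (\<forall>k\<le>s. sup_norm (nth_deriv k f) \<le> 1) \<and>
            sup_norm (\<lambda>p. jackknife_mean f n r p - f p)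
              \<ge> min c1 c2 * real n powi (int r - 1 - int s)"
    if n: "n \<ge> r" for n
  proof -
    \<comment> \<open>The exponent may be negative, so the rate is written as a quotient of natural
      powers.\<close>
    have pw: "real n powi (int r - 1 - int s) = real n ^ (r - 1) / real n ^ s"
      using n r power_int_diff[of "real n" "int (r - 1)" "int s"] by (simp add: of_nat_diff flip: power_int_of_nat)
    show ?thesis
    proof (cases "3 * r \<le> n")
      case True
      have "min c1 c2 * (real n ^ (r - 1) / real n ^ s) \<le> c1 * (real n ^ (r - 1) / real n ^ s)"
        by (intro mult_right_mono) auto
      then have "sup_norm (\<lambda>p. jackknife_mean (wave s n) n r p - wave s n p)
          \<ge> min c1 c2 * real n powi (int r - 1 - int s)"
        using sup_norm_bias_wave_ge_large[OF r True, of s] unfolding pw c1_def by linarith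
      then show ?thesis
        using n r by (intro exI[of _ "wave s n"] conjI allI impI wave_in_C_space
            sup_norm_nth_deriv_wave) auto
    next
      case False
      have "real n ^ (r - 1) / real n ^ s \<le> real n ^ (r - 1) / 1"
        using n r by (intro divide_left_mono one_le_power) auto
      also have "\<dots> \<le> (3 * real r) ^ (r - 1)"
        unfolding div_by_1 using False by (intro power_mono) linarith+
      finally have "min c1 c2 * (real n ^ (r - 1) / real n ^ s) \<le> c2 * (3 * real r) ^ (r - 1)"
        using pos by (intro mult_mono) auto
      also have "\<dots> = 1 / (2 * pi * fact (3 * r)) ^ s"
        using r by (simp add: c2_def)
      also have "\<dots> \<le> sup_norm (\<lambda>p. jackknife_mean (wave s (fact (3 * r))) n r p
                                  - wave s (fact (3 * r)) p)"
        using False n by (intro sup_norm_bias_wave_ge_small) auto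
      finally show ?thesis
        unfolding pw
        by (intro exI[of _ "wave s (fact (3 * r))"] conjI allI impI wave_in_C_space
            sup_norm_nth_deriv_wave) (auto simp: fact_ge_1)
    qed
  qed
  then show ?thesis using pos by (intro exI[of _ "min c1 c2"]) auto
qed

end
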